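(* Let $(U,p)$ be a partial metric space. If the topological space $(U,\mathcal{T}[p])$ is sequentially compact, then it is compact.
   Context: Let $\mathbb{R}_+=[0,\infty)$. A partial metric on a nonempty set $U$ is a function $p:U\times U\to\mathbb{R}_+$ such that for all $x,y,z\in U$: (1) $x=y \Leftrightarrow p(x,x)=p(x,y)=p(y,y)$; (2) $p(x,x)\le p(y,x)$; (3) $p(x,y)=p(y,x)$; (4) $p(x,y)\le p(x,z)+p(z,y)-p(z,z)$. The pair $(U,p)$ is called a partial metric space. For $x\in U$ and $\varepsilon>0$ the open ball is $B(x,\varepsilon)=\{y\in U: p(x,y)<p(x,x)+\varepsilon\}$; the open balls form a basis of a topology on $U$ denoted $\mathcal{T}[p]$. A sequence $(x_n)$ converges to $x$ in $(U,p)$ if $\lim_{n\to\infty}p(x_n,x)=p(x,x)$ (this is equivalent to convergence in $\mathcal{T}[p]$). A topological space is compact if every open cover has a finite subcover (no separation axiom is assumed). It is sequentially compact if every sequence of its elements has a convergent subsequence. Topological properties of $(U,p)$ refer to $(U,\mathcal{T}[p])$. *)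

theory Defs
  imports "HOL-Analysis.Analysis"
begin

locale partial_metric_space =
  fixes U :: "'a set" and p :: "'a \<Rightarrow> 'a \<Rightarrow> real"
  assumes carrier_nonempty: "U \<noteq> {}"
    and nonneg: "\<lbrakk>x \<in> U; y \<in> U\<rbrakk> \<Longrightarrow> 0 \<le> p x y"
    and eq_iff: "\<lbrakk>x \<in> U; y \<in> U\<rbrakk> \<Longrightarrow> x = y \<longleftrightarrow> p x x = p x y \<and> p x y = p y y"
    and self_le: "\<lbrakk>x \<in> U; y \<in> U\<rbrakk> \<Longrightarrow> p x x \<le> p y x"
    and commute: "\<lbrakk>x \<in> U; y \<in> U\<rbrakk> \<Longrightarrow> p x y = p y x"
    and triangle: "\<lbrakk>x \<in> U; y \<in> U; z \<in> U\<rbrakk> \<Longrightarrow> p x y \<le> p x z + p z y - p z z"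

definition pball :: "'a set \<Rightarrow> ('a \<Rightarrow> 'a \<Rightarrow> real) \<Rightarrow> 'a \<Rightarrow> real \<Rightarrow> 'a set" where
  "pball U p x \<epsilon> = {y \<in> U. p x y < p x x + \<epsilon>}"

(* The topology with the open balls as a basis.  The partial metric axioms are needed for the
   unions of balls to be a topology; see openin_ptopology below. *)
definition ptopology :: "'a set \<Rightarrow> ('a \<Rightarrow> 'a \<Rightarrow> real) \<Rightarrow> 'a topology" where
  "ptopology U p = topology (arbitrary union_of (\<lambda>B. \<exists>x\<in>U. \<exists>\<epsilon>>0. B = pball U p x \<epsilon>))"

(* seq_compact from the library is about sets in a topological_space type; this is the
   corresponding notion for an abstract topology.  Limits are not assumed unique. *)
definition seq_compact_space :: "'a topology \<Rightarrow> bool" where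
  "seq_compact_space X \<longleftrightarrow>
     (\<forall>s :: nat \<Rightarrow> 'a. range s \<subseteq> topspace X \<longrightarrow>
        (\<exists>l r. strict_mono (r :: nat \<Rightarrow> nat) \<and> limitin X (s \<circ> r) l sequentially))"

context partial_metric_space
begin

lemma centre_in_pball: "x \<in> U \<Longrightarrow> \<epsilon> > 0 \<Longrightarrow> x \<in> pball U p x \<epsilon>"
  by (simp add: pball_def)

lemma pball_subset_pball:
  assumes "x \<in> U" "y \<in> pball U p x \<epsilon>"
  obtains \<delta> where "\<delta> > 0" "pball U p y \<delta> \<subseteq> pball U p x \<epsilon>"
proof
  let ?\<delta> = "p x x + \<epsilon> - p x y"
  show "?\<delta> > 0" using assms by (simp add: pball_def)
  show "pball U p y ?\<delta> \<subseteq> pball U p x \<epsilon>"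
  proof
    fix z assume "z \<in> pball U p y ?\<delta>"
    then show "z \<in> pball U p x \<epsilon>"
      using assms triangle[of x z y] by (simp add: pball_def)
  qed
qed

lemma union_of_pballs_iff:
  "(arbitrary union_of (\<lambda>B. \<exists>x\<in>U. \<exists>\<epsilon>>0. B = pball U p x \<epsilon>)) S \<longleftrightarrow>
     S \<subseteq> U \<and> (\<forall>x\<in>S. \<exists>\<epsilon>>0. pball U p x \<epsilon> \<subseteq> S)" (is "?L \<longleftrightarrow> ?R")
proof
  assume L: ?L
  show ?R
  proof (intro conjI ballI subsetI)
    fix y assume "y \<in> S"
    with L obtain x \<epsilon> where "x \<in> U" "y \<in> pball U p x \<epsilon>" "pball U p x \<epsilon> \<subseteq> S"
      unfolding arbitrary_union_of_alt by blast
    then show "y \<in> U" by (simp add: pball_def)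
    from pball_subset_pball[OF \<open>x \<in> U\<close> \<open>y \<in> pball U p x \<epsilon>\<close>]
    obtain \<delta> where "\<delta> > 0" "pball U p y \<delta> \<subseteq> pball U p x \<epsilon>" .
    with \<open>pball U p x \<epsilon> \<subseteq> S\<close> show "\<exists>\<delta>>0. pball U p y \<delta> \<subseteq> S" by blast
  qed
next
  assume ?R
  then show ?L
    unfolding arbitrary_union_of_alt by (metis centre_in_pball subsetD)
qed

lemma openin_ptopology:
  "openin (ptopology U p) S \<longleftrightarrow>
     (arbitrary union_of (\<lambda>B. \<exists>x\<in>U. \<exists>\<epsilon>>0. B = pball U p x \<epsilon>)) S"
proof -
  have "istopology (arbitrary union_of (\<lambda>B. \<exists>x\<in>U. \<exists>\<epsilon>>0. B = pball U p x \<epsilon>))"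
    unfolding istopology_base_alt
  proof (intro allI impI)
    fix S T
    assume A: "(arbitrary union_of (\<lambda>B. \<exists>x\<in>U. \<exists>\<epsilon>>0. B = pball U p x \<epsilon>)) S \<and>
               (arbitrary union_of (\<lambda>B. \<exists>x\<in>U. \<exists>\<epsilon>>0. B = pball U p x \<epsilon>)) T"
    show "(arbitrary union_of (\<lambda>B. \<exists>x\<in>U. \<exists>\<epsilon>>0. B = pball U p x \<epsilon>)) (S \<inter> T)"
      unfolding union_of_pballs_iff
    proof (intro conjI ballI)
      show "S \<inter> T \<subseteq> U" using A unfolding union_of_pballs_iff by blast
      fix x assume "x \<in> S \<inter> T"
      then obtain a b where "a > 0" "b > 0" "pball U p x a \<subseteq> S" "pball U p x b \<subseteq> T"
        using A unfolding union_of_pballs_iff by blast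
      moreover have "pball U p x (min a b) \<subseteq> pball U p x a \<inter> pball U p x b"
        by (auto simp: pball_def)
      ultimately show "\<exists>\<epsilon>>0. pball U p x \<epsilon> \<subseteq> S \<inter> T"
        by (intro exI[of _ "min a b"]) auto
    qed
  qed
  then show ?thesis
    by (simp add: ptopology_def topology_inverse')
qed

lemma openin_ptopology_iff:
  "openin (ptopology U p) S \<longleftrightarrow> S \<subseteq> U \<and> (\<forall>x\<in>S. \<exists>\<epsilon>>0. pball U p x \<epsilon> \<subseteq> S)"
  by (simp add: openin_ptopology union_of_pballs_iff)

lemma topspace_ptopology: "topspace (ptopology U p) = U"
proof
  have "pball U p x 1 \<subseteq> U" for x by (auto simp: pball_def)
  then have "openin (ptopology U p) U"
    unfolding openin_ptopology_iff by (meson order_refl zero_less_one)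
  then show "U \<subseteq> topspace (ptopology U p)" by (rule openin_subset)
  show "topspace (ptopology U p) \<subseteq> U"
    using openin_topspace[of "ptopology U p"] unfolding openin_ptopology_iff by blast
qed

lemma openin_pball: "x \<in> U \<Longrightarrow> openin (ptopology U p) (pball U p x \<epsilon>)"
  unfolding openin_ptopology_iff
  by (auto simp: pball_def[of U p x \<epsilon>, symmetric] elim: pball_subset_pball)
     (simp add: pball_def)

lemma limitin_ptopology:
  assumes s: "range s \<subseteq> U" and x: "x \<in> U"
  shows "limitin (ptopology U p) s x sequentially \<longleftrightarrow> (\<lambda>n. p (s n) x) \<longlonglongrightarrow> p x x"
    (is "?L \<longleftrightarrow> ?R")
proof -
  have sU: "s n \<in> U" for n using s by blast
  have ball: "s n \<in> pball U p x \<epsilon> \<longleftrightarrow> dist (p (s n) x) (p x x) < \<epsilon>" for n \<epsilon>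
    using self_le[OF x sU[of n]] commute[OF x sU[of n]] sU[of n]
    by (auto simp: pball_def dist_real_def)
  have "?L \<longleftrightarrow> (\<forall>\<epsilon>>0. \<forall>\<^sub>F n in sequentially. s n \<in> pball U p x \<epsilon>)"
  proof
    assume ?L
    then show "\<forall>\<epsilon>>0. \<forall>\<^sub>F n in sequentially. s n \<in> pball U p x \<epsilon>"
      using x by (simp add: limitin_def openin_pball centre_in_pball)
  next
    assume ev: "\<forall>\<epsilon>>0. \<forall>\<^sub>F n in sequentially. s n \<in> pball U p x \<epsilon>"
    show ?L
      unfolding limitin_def topspace_ptopology
    proof (intro conjI allI impI x)
      fix V assume "openin (ptopology U p) V \<and> x \<in> V"
      then obtain \<epsilon> where "\<epsilon> > 0" "pball U p x \<epsilon> \<subseteq> V"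
        unfolding openin_ptopology_iff by blast
      then show "\<forall>\<^sub>F n in sequentially. s n \<in> V"
        using ev by (metis (mono_tags, lifting) eventually_mono subsetD)
    qed
  qed
  then show ?thesis by (simp add: ball tendsto_iff)
qed

end

end

theory Submission
  imports Defs
begin

text \<open>
  The proof follows the classical one for metric spaces: sequential compactness yields a Lebesgue
  number \<open>\<epsilon>\<close> for an open cover (\<open>lebesgue_number\<close>) and a finite \<open>\<epsilon>\<close>-net
  (\<open>finite_net\<close>), and the cover members that contain the balls around the net form a finite
  subcover.

  The Lebesgue number is obtained as in a metric space, because the triangle inequality bounds
  \<open>p x y - p x x\<close> by \<open>(p x z - p x x) + (p z y - p z z)\<close>, so that the quasi-metric
  \<open>p x y - p x x\<close>, whose balls are the open balls of \<open>p\<close>, is all that matters.  The finite net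
  needs more.  If points \<open>s n\<close> are chosen greedily outside the \<open>\<epsilon>\<close>-balls around their
  predecessors and a subsequence converges to \<open>x\<close>, then \<open>p (s n) x\<close> tends to \<open>p x x\<close>, but the
  self-distances \<open>p (s n) (s n)\<close> may stay far below \<open>p x x\<close>, and then \<open>x\<close> is in no
  \<open>\<epsilon>\<close>-ball around an \<open>s n\<close> and there is no contradiction.  The remedy is to choose \<open>s n\<close>
  with a self-distance that is almost maximal among the points not yet covered, which is possible
  because self-distances are bounded (\<open>self_distance_bounded\<close>).  The uncovered points form a
  closed set, so \<open>x\<close> is never covered and competes in every choice; hence \<open>p x x\<close> cannot exceed
  \<open>p (s n) (s n)\<close> by more than a fraction of \<open>\<epsilon>\<close>, which does put \<open>x\<close> into an
  \<open>\<epsilon>\<close>-ball around some \<open>s n\<close>.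
\<close>

context partial_metric_space
begin

lemma convergent_subsequence:
  assumes "seq_compact_space (ptopology U p)" and s: "range s \<subseteq> U"
  obtains x and r :: "nat \<Rightarrow> nat" where "x \<in> U" "strict_mono r"
    "limitin (ptopology U p) (s \<circ> r) x sequentially"
    "(\<lambda>n. p (s (r n)) x) \<longlonglongrightarrow> p x x"
proof -
  obtain x r where r: "strict_mono (r :: nat \<Rightarrow> nat)"
    and lim: "limitin (ptopology U p) (s \<circ> r) x sequentially"
    using assms unfolding seq_compact_space_def topspace_ptopology by blast
  have x: "x \<in> U"
    using limitin_topspace[OF lim] by (simp add: topspace_ptopology)
  have "range (s \<circ> r) \<subseteq> U" using s by auto
  from limitin_ptopology[OF this x] lim have "(\<lambda>n. p (s (r n)) x) \<longlonglongrightarrow> p x x"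
    by simp
  with x r lim show thesis by (rule that)
qed

text \<open>
  A self-distance is at most the distance to any other point, and the distances to the limit of a
  convergent sequence are bounded.
\<close>
lemma self_distance_bounded:
  assumes sc: "seq_compact_space (ptopology U p)"
  shows "bdd_above ((\<lambda>u. p u u) ` U)"
proof (rule ccontr)
  assume "\<not> ?thesis"
  then have "\<exists>u\<in>U. real n < p u u" for n :: nat
    by (auto simp: bdd_above_def not_le)
  then obtain s where s: "\<And>n. s n \<in> U" "\<And>n. real n < p (s n) (s n)"
    by metis
  have "range s \<subseteq> U" using s(1) by blast
  then obtain x r where x: "x \<in> U" and r: "strict_mono r"
    and "limitin (ptopology U p) (s \<circ> r) x sequentially"
    and lim: "(\<lambda>n. p (s (r n)) x) \<longlonglongrightarrow> p x x"
    by (rule convergent_subsequence[OF sc])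
  have "\<forall>\<^sub>F n in sequentially. p (s (r n)) x < p x x + 1"
    using order_tendstoD(2)[OF lim] by simp
  then obtain N where N: "\<And>n. n \<ge> N \<Longrightarrow> p (s (r n)) x < p x x + 1"
    by (auto simp: eventually_sequentially)
  define n where "n = max N (nat \<lceil>p x x + 1\<rceil>)"
  have "p x x + 1 \<le> real n"
    unfolding n_def by linarith
  also have "\<dots> \<le> real (r n)"
    using seq_suble[OF r] by simp
  also have "\<dots> < p (s (r n)) (s (r n))"
    by (rule s(2))
  also have "\<dots> \<le> p (s (r n)) x"
    using self_le[OF s(1) x] commute[OF s(1) x] by simp
  also have "\<dots> < p x x + 1"
    by (rule N) (simp add: n_def)
  finally show False .
qed

text \<open>
  If small balls around points \<open>s n\<close> were in no member of the cover, then neither would they be in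
  the ball around a limit \<open>x\<close> that is contained in a member; but the triangle inequality through
  \<open>s n\<close> puts them there.
\<close>
lemma lebesgue_number:
  assumes sc: "seq_compact_space (ptopology U p)"
    and op: "\<And>C. C \<in> \<C> \<Longrightarrow> openin (ptopology U p) C" and cover: "U \<subseteq> \<Union>\<C>"
  obtains \<epsilon> where "\<epsilon> > 0" "\<And>x. x \<in> U \<Longrightarrow> \<exists>C\<in>\<C>. pball U p x \<epsilon> \<subseteq> C"
proof (rule ccontr)
  assume "\<not> thesis"
  with that have "\<exists>x\<in>U. \<forall>C\<in>\<C>. \<not> pball U p x \<epsilon> \<subseteq> C" if "\<epsilon> > 0" for \<epsilon>
    using \<open>\<epsilon> > 0\<close> by blast
  then have "\<exists>x\<in>U. \<forall>C\<in>\<C>. \<not> pball U p x (inverse (Suc n)) \<subseteq> C" for n :: nat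
    by simp
  then obtain s where s: "\<And>n. s n \<in> U"
    and bad: "\<And>n C. C \<in> \<C> \<Longrightarrow> \<not> pball U p (s n) (inverse (Suc n)) \<subseteq> C"
    by metis
  have "range s \<subseteq> U" using s by blast
  then obtain x r where x: "x \<in> U" and r: "strict_mono r"
    and "limitin (ptopology U p) (s \<circ> r) x sequentially"
    and lim: "(\<lambda>n. p (s (r n)) x) \<longlonglongrightarrow> p x x"
    by (rule convergent_subsequence[OF sc])
  obtain C where C: "C \<in> \<C>" "x \<in> C"
    using cover x by blast
  obtain \<epsilon> where \<epsilon>: "\<epsilon> > 0" "pball U p x \<epsilon> \<subseteq> C"
    using op C unfolding openin_ptopology_iff by blast
  have "(\<lambda>n. inverse (real (Suc (r n)))) \<longlonglongrightarrow> 0"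
    using LIMSEQ_subseq_LIMSEQ[OF LIMSEQ_inverse_real_of_nat r] by (simp add: o_def)
  from tendsto_add[OF lim this]
  have "\<forall>\<^sub>F n in sequentially. p (s (r n)) x + inverse (Suc (r n)) < p x x + \<epsilon>"
    using \<epsilon>(1) by (intro order_tendstoD(2)) auto
  then obtain n where n: "p (s (r n)) x + inverse (Suc (r n)) < p x x + \<epsilon>"
    by (auto simp: eventually_sequentially)
  have "pball U p (s (r n)) (inverse (Suc (r n))) \<subseteq> pball U p x \<epsilon>"
  proof
    fix y assume "y \<in> pball U p (s (r n)) (inverse (Suc (r n)))"
    then have "y \<in> U" "p (s (r n)) y < p (s (r n)) (s (r n)) + inverse (Suc (r n))"
      by (auto simp: pball_def)
    then show "y \<in> pball U p x \<epsilon>"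
      using triangle[OF x _ s, of y "r n"] commute[OF x s, of "r n"] n
      by (simp add: pball_def)
  qed
  with \<epsilon>(2) bad[OF C(1)] show False by blast
qed

text \<open>
  The tolerance \<open>\<epsilon> / 2\<close> in the choice of almost maximal self-distances leaves the other half of
  \<open>\<epsilon>\<close> for the convergence \<open>p (s n) x \<longlonglongrightarrow> p x x\<close>; the two estimates add up to
  \<open>p (s n) x < p (s n) (s n) + \<epsilon>\<close>.
\<close>
lemma finite_net:
  assumes sc: "seq_compact_space (ptopology U p)" and \<epsilon>: "\<epsilon> > 0"
  obtains F where "finite F" "F \<subseteq> U" "U \<subseteq> (\<Union>x\<in>F. pball U p x \<epsilon>)"
proof (rule ccontr)
  assume "\<not> thesis"
  with that have no_net: "\<And>F. finite F \<Longrightarrow> F \<subseteq> U \<Longrightarrow> \<not> U \<subseteq> (\<Union>x\<in>F. pball U p x \<epsilon>)"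
    by blast
  \<comment> \<open>\<open>R f n\<close> is what the balls around \<open>f 0, \<dots>, f (n - 1)\<close> leave uncovered; \<open>P f n z\<close> says
    that the greedy construction may continue with \<open>z\<close>.\<close>
  define R where "R f n = U - (\<Union>i<n. pball U p (f i) \<epsilon>)" for f and n :: nat
  define P where "P f n z \<longleftrightarrow> z \<in> R f n \<and> (\<forall>y\<in>R f n. p y y < p z z + \<epsilon> / 2)" for f n z
  have choice: "\<exists>z. P f n z" if prev: "\<And>i. i < n \<Longrightarrow> P f i (f i)" for f n
  proof -
    let ?S = "(\<lambda>u. p u u) ` R f n"
    have "f ` {..<n} \<subseteq> U"
      using prev by (auto simp: P_def R_def)
    with no_net[of "f ` {..<n}"] have "?S \<noteq> {}"
      by (auto simp: R_def)
    moreover have "bdd_above ?S"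
      by (rule bdd_above_mono[OF self_distance_bounded[OF sc]]) (auto simp: R_def)
    ultimately obtain z where z: "z \<in> R f n" "Sup ?S - \<epsilon> / 2 < p z z"
      using less_cSupD[of ?S "Sup ?S - \<epsilon> / 2"] \<epsilon> by auto
    have "p y y < p z z + \<epsilon> / 2" if "y \<in> R f n" for y
      using cSup_upper[OF imageI[OF that] \<open>bdd_above ?S\<close>] z(2) by simp
    with z(1) show ?thesis unfolding P_def by blast
  qed
  have "P f n z \<longleftrightarrow> P g n z" if "\<And>i. i < n \<Longrightarrow> f i = g i" for f g n z
  proof -
    have "R f n = R g n" using that by (auto simp: R_def)
    then show ?thesis by (simp add: P_def)
  qed
  from dependent_wellorder_choice[of P, OF this choice]
  obtain s where P: "\<And>n. P s n (s n)"
    by blast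
  then have s: "s n \<in> U" for n
    by (auto simp: P_def R_def)
  have "range s \<subseteq> U" using s by blast
  then obtain x r where x: "x \<in> U" and r: "strict_mono r"
    and lim: "limitin (ptopology U p) (s \<circ> r) x sequentially"
    and dist_lim: "(\<lambda>n. p (s (r n)) x) \<longlonglongrightarrow> p x x"
    by (rule convergent_subsequence[OF sc])
  \<comment> \<open>The balls are open: one that contained \<open>x\<close> would contain later terms of the sequence.\<close>
  have outside: "x \<notin> pball U p (s i) \<epsilon>" for i
  proof
    assume "x \<in> pball U p (s i) \<epsilon>"
    with lim openin_pball[OF s]
    have "\<forall>\<^sub>F n in sequentially. s (r n) \<in> pball U p (s i) \<epsilon>"
      by (simp add: limitin_def)
    then obtain N where N: "\<And>n. n \<ge> N \<Longrightarrow> s (r n) \<in> pball U p (s i) \<epsilon>"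
      by (auto simp: eventually_sequentially)
    define n where "n = max N (Suc i)"
    have "i < r n"
      using seq_suble[OF r, of n] by (simp add: n_def)
    with P[of "r n"] have "s (r n) \<notin> pball U p (s i) \<epsilon>"
      by (auto simp: P_def R_def)
    with N[of n] show False by (simp add: n_def)
  qed
  have "\<forall>\<^sub>F n in sequentially. p (s (r n)) x < p x x + \<epsilon> / 2"
    using order_tendstoD(2)[OF dist_lim] \<epsilon> by simp
  then obtain n where n: "p (s (r n)) x < p x x + \<epsilon> / 2"
    by (auto simp: eventually_sequentially)
  have "x \<in> R s (r n)"
    using x outside by (simp add: R_def)
  with P[of "r n"] have "p x x < p (s (r n)) (s (r n)) + \<epsilon> / 2"
    by (simp add: P_def)
  with n x have "x \<in> pball U p (s (r n)) \<epsilon>"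
    by (simp add: pball_def)
  with outside show False by blast
qed

end

theorem theorem4p9:
  fixes U :: "'a set" and p :: "'a \<Rightarrow> 'a \<Rightarrow> real"
  assumes "partial_metric_space U p"
    and "seq_compact_space (ptopology U p)"
  shows "compact_space (ptopology U p)"
proof -
  interpret partial_metric_space U p by fact
  show ?thesis
    unfolding compact_space_alt topspace_ptopology
  proof (intro allI impI)
    fix \<C> assume \<C>: "(\<forall>C\<in>\<C>. openin (ptopology U p) C) \<and> U \<subseteq> \<Union>\<C>"
    obtain \<epsilon> where \<epsilon>: "\<epsilon> > 0" and "\<And>x. x \<in> U \<Longrightarrow> \<exists>C\<in>\<C>. pball U p x \<epsilon> \<subseteq> C"
      using lebesgue_number[OF assms(2), of \<C>] \<C> by blast
    then obtain c where c: "\<And>x. x \<in> U \<Longrightarrow> c x \<in> \<C> \<and> pball U p x \<epsilon> \<subseteq> c x"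
      by metis
    obtain F where F: "finite F" "F \<subseteq> U" "U \<subseteq> (\<Union>x\<in>F. pball U p x \<epsilon>)"
      using finite_net[OF assms(2) \<epsilon>] .
    have "U \<subseteq> \<Union>(c ` F)"
      using F c by blast
    moreover have "finite (c ` F)" "c ` F \<subseteq> \<C>"
      using F c by auto
    ultimately show "\<exists>\<F>. finite \<F> \<and> \<F> \<subseteq> \<C> \<and> U \<subseteq> \<Union>\<F>"
      by blast
  qed
qed

end
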